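(* Let $q$ be a prime power. In each part below assume $k\leq\binom{n}{2}$. (i) If $n=k=q^2+q+1$, then $M(k,n)=(q^2+q+1)q=qk=\frac{2}{q+1}\binom{n}{2}$. (ii) If $n=q^2$ and $k=q^2+q$, then $M(k,n)=(q+1)q(q-1)=(q-1)k=\frac{2}{q}\binom{n}{2}$. (iii) If $n=q^2+q$ and $k=q^2+q+1$, then $M(k,n)=q^3+q^2-1=qk-q-1$. (iv) If $n=q^2-1$ and $k=q^2+q$, then $M(k,n)=q^3-2q-1=(q-1)k-q-1$. (v) If $n=q^2-q$ and $k=q^2+q-1$, then $M(k,n)=q^3-q^2-2q+1=(q-2)k+q-1$.
   Context: For a finite graph $G$, $\mathrm{Mad}(G)=\max\{2e(H)/|V(H)| : H\subseteq G,\ |V(H)|\geq 1\}$ ($0$ if edgeless). For $1\leq k\leq\binom{n}{2}$, $M(k,n)$ is the maximum of $\sum_{i=1}^k\mathrm{Mad}(G_i)$ over all partitions of $E(K_n)$ into $k$ spanning subgraphs $G_1,\dots,G_k$. *)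

theory Defs
  imports
    Complex_Main
    "HOL-Library.Disjoint_Sets"
    "HOL-Number_Theory.Prime_Powers"
begin

type_synonym 'a graph = "'a set \<times> 'a set set"

abbreviation verts :: "'a graph \<Rightarrow> 'a set" where
  "verts G \<equiv> fst G"

abbreviation edges :: "'a graph \<Rightarrow> 'a set set" where
  "edges G \<equiv> snd G"

definition is_graph :: "'a graph \<Rightarrow> bool" where
  "is_graph G \<longleftrightarrow> finite (verts G) \<and> (\<forall>e\<in>edges G. e \<subseteq> verts G \<and> card e = 2)"

definition subgraph :: "'a graph \<Rightarrow> 'a graph \<Rightarrow> bool" where
  "subgraph H G \<longleftrightarrow> is_graph H \<and> verts H \<subseteq> verts G \<and> edges H \<subseteq> edges G"

definition spanning_subgraph :: "'a graph \<Rightarrow> 'a graph \<Rightarrow> bool" where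
  "spanning_subgraph H G \<longleftrightarrow> subgraph H G \<and> verts H = verts G"

definition complete_graph :: "nat \<Rightarrow> nat graph" where
  "complete_graph n = ({1..n}, {e. e \<subseteq> {1..n} \<and> card e = 2})"

definition Mad :: "'a graph \<Rightarrow> real" where
  "Mad G = (if edges G = {} then 0
     else Max {2 * real (card (edges H)) / real (card (verts H)) |H.
                 subgraph H G \<and> card (verts H) \<ge> 1})"

text \<open>Parts without edges are allowed. Values of the family outside \<open>{1..k}\<close> are irrelevant.\<close>

definition edge_partition :: "nat \<Rightarrow> nat \<Rightarrow> (nat \<Rightarrow> nat graph) \<Rightarrow> bool" where
  "edge_partition k n G \<longleftrightarrow>
     (\<forall>i\<in>{1..k}. spanning_subgraph (G i) (complete_graph n)) \<and>
     disjoint_family_on (\<lambda>i. edges (G i)) {1..k} \<and>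
     (\<Union>i\<in>{1..k}. edges (G i)) = edges (complete_graph n)"

definition M :: "nat \<Rightarrow> nat \<Rightarrow> real" where
  "M k n = Max {\<Sum>i=1..k. Mad (G i) |G. edge_partition k n G}"

text \<open>The two maxima range over finite nonempty sets.\<close>

lemma is_graph_complete_graph: "is_graph (complete_graph n)"
  by (auto simp: is_graph_def complete_graph_def)

lemma finite_subgraphs:
  assumes "is_graph G"
  shows "finite {H. subgraph H G}"
proof (rule finite_subset)
  have "edges G \<subseteq> Pow (verts G)" "finite (verts G)"
    using assms by (auto simp: is_graph_def)
  then have "finite (edges G)"
    by (meson finite_Pow_iff finite_subset)
  then show "finite (Pow (verts G) \<times> Pow (edges G))"
    using \<open>finite (verts G)\<close> by simp
  show "{H. subgraph H G} \<subseteq> Pow (verts G) \<times> Pow (edges G)"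
    by (auto simp: subgraph_def)
qed

lemma Mad_set_finite:
  assumes "is_graph G"
  shows "finite {2 * real (card (edges H)) / real (card (verts H)) |H.
                   subgraph H G \<and> card (verts H) \<ge> 1}"
  by (rule finite_subset[OF _ finite_imageI[OF finite_subgraphs[OF assms],
        of "\<lambda>H. 2 * real (card (edges H)) / real (card (verts H))"]]) blast

lemma Mad_set_nonempty:
  assumes "is_graph G" "edges G \<noteq> {}"
  shows "{2 * real (card (edges H)) / real (card (verts H)) |H.
            subgraph H G \<and> card (verts H) \<ge> 1} \<noteq> {}"
proof -
  obtain e where e: "e \<in> edges G" "e \<subseteq> verts G" "card e = 2"
    using assms by (auto simp: is_graph_def)
  then have "verts G \<noteq> {}"
    by auto
  then have "card (verts G) \<ge> 1"
    using assms(1) by (simp add: is_graph_def Suc_le_eq card_gt_0_iff)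
  moreover have "subgraph G G"
    using assms(1) by (simp add: subgraph_def)
  ultimately show ?thesis
    by blast
qed

lemma M_set_finite: "finite {\<Sum>i=1..k. Mad (G i) |G. edge_partition k n G}"
proof (rule finite_subset)
  let ?S = "{H. subgraph H (complete_graph n)}"
  have "finite ({1..k} \<rightarrow>\<^sub>E ?S)"
    by (intro finite_PiE finite_subgraphs is_graph_complete_graph) simp
  then show "finite ((\<lambda>G. \<Sum>i=1..k. Mad (G i)) ` ({1..k} \<rightarrow>\<^sub>E ?S))"
    by (rule finite_imageI)
  show "{\<Sum>i=1..k. Mad (G i) |G. edge_partition k n G}
          \<subseteq> (\<lambda>G. \<Sum>i=1..k. Mad (G i)) ` ({1..k} \<rightarrow>\<^sub>E ?S)"
  proof clarify
    fix G assume "edge_partition k n G"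
    then have "restrict G {1..k} \<in> {1..k} \<rightarrow>\<^sub>E ?S"
      by (auto simp: edge_partition_def spanning_subgraph_def)
    moreover have "(\<Sum>i=1..k. Mad (G i)) = (\<Sum>i=1..k. Mad (restrict G {1..k} i))"
      by (rule sum.cong) auto
    ultimately show "(\<Sum>i=1..k. Mad (G i)) \<in> (\<lambda>G. \<Sum>i=1..k. Mad (G i)) ` ({1..k} \<rightarrow>\<^sub>E ?S)"
      by blast
  qed
qed

lemma M_set_nonempty:
  assumes "k \<ge> 1"
  shows "{\<Sum>i=1..k. Mad (G i) |G. edge_partition k n G} \<noteq> {}"
proof -
  let ?G = "\<lambda>i::nat. if i = 1 then complete_graph n else ({1..n}, {})"
  have "(\<Union>i\<in>{1..k}. edges (?G i)) = edges (complete_graph n)"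
    using assms by (auto split: if_splits)
  then have "edge_partition k n ?G"
    using is_graph_complete_graph[of n]
    by (auto simp: edge_partition_def spanning_subgraph_def subgraph_def
        disjoint_family_on_def is_graph_def complete_graph_def)
  then show ?thesis
    by blast
qed

end

theory Submission
  imports Defs "HOL-Number_Theory.Residues" "HOL-Algebra.Algebraic_Closure"
begin

text \<open>
  Upper bound: a part with \<open>e\<close> edges satisfies \<open>2 m Mad \<le> 2 e + m (m - 1)\<close> for every natural number
  \<open>m\<close>, with equality for the cliques on \<open>m\<close> and \<open>m + 1\<close> vertices. Summing over the parts gives
  \<open>2 m M(k, n) \<le> n (n - 1) + k m (m - 1)\<close>.

  Lower bound: a linear space with \<open>n\<close> points and \<open>k\<close> lines partitions the complete graph into cliques.
  If all lines have \<open>m\<close> or \<open>m + 1\<close> points, this attains the upper bound. The five cases are a projective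
  plane, an affine plane, a projective plane minus a point, an affine plane minus a point and an
  affine plane minus a line, with \<open>m = q\<close> in (i) and (iii) and \<open>m = q - 1\<close> in (ii), (iv) and (v).

  The planes are coordinatized by a field of order \<open>q = p ^ d\<close>, obtained as the fixed points of the
  \<open>d\<close>-th Frobenius power in an algebraic closure of the prime field.
\<close>

section \<open>Finite fields of prime power order\<close>

lemma (in cring) binomial_expansion:
  assumes [simp]: "a \<in> carrier R" "b \<in> carrier R"
  shows "(a \<oplus> b) [^] (n::nat) = (\<Oplus>i\<in>{..n}. add_pow R (n choose i) (a [^] i \<otimes> b [^] (n - i)))"
proof (induction n)
  case 0
  then show ?case by (simp add: add_pow_def)
next
  case (Suc n)
  \<comment> \<open>\<open>T n i\<close> is the \<open>i\<close>-th binomial term and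
    \<open>U i\<close> is that term times \<open>b\<close>. \<open>U\<close> is written with the
    exponent \<open>Suc n - i\<close> so that it also makes sense at \<open>i = Suc n\<close>, where
    the binomial coefficient vanishes and the sum may be extended.\<close>
  define T where "T n i = add_pow R (n choose i) (a [^] i \<otimes> b [^] (n - i))" for n i :: nat
  define U where "U i = add_pow R (n choose i) (a [^] i \<otimes> b [^] (Suc n - i))" for i :: nat
  have [simp]: "T m i \<in> carrier R" "U i \<in> carrier R" for m i
    by (simp_all add: T_def U_def)
  \<comment> \<open>This is Pascal's rule; \<open>T (Suc n) 0\<close> has no predecessor and becomes
    \<open>U 0\<close> below.\<close>
  have step: "T (Suc n) (Suc i) = T n i \<otimes> a \<oplus> U (Suc i)" for i
  proof -
    have "T n i \<otimes> a = add_pow R (n choose i) (a [^] Suc i \<otimes> b [^] (n - i))"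
      unfolding T_def by (simp add: add_pow_ldistr add_pow_rdistr m_ac)
    then show ?thesis
      by (simp add: T_def U_def add.nat_pow_mult)
  qed
  have Ub: "U i = T n i \<otimes> b" if "i \<le> n" for i
    using that unfolding T_def U_def by (simp add: add_pow_ldistr m_assoc Suc_diff_le)
  have U_end: "U (Suc n) = \<zero>"
    by (simp add: U_def add_pow_def binomial_eq_0)
  have "(\<Oplus>i\<in>{..Suc n}. T (Suc n) i) = (\<Oplus>i\<in>{..n}. T (Suc n) (Suc i)) \<oplus> T (Suc n) 0"
    by (subst finsum_Suc2) (auto simp: Pi_def)
  also have "T (Suc n) 0 = U 0"
    by (simp add: T_def U_def)
  also have "(\<Oplus>i\<in>{..n}. T (Suc n) (Suc i)) = (\<Oplus>i\<in>{..n}. T n i \<otimes> a) \<oplus> (\<Oplus>i\<in>{..n}. U (Suc i))"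
    unfolding step by (rule finsum_addf) (auto simp: Pi_def)
  also have "\<dots> \<oplus> U 0 = (\<Oplus>i\<in>{..n}. T n i \<otimes> a) \<oplus> ((\<Oplus>i\<in>{..n}. U (Suc i)) \<oplus> U 0)"
    by (rule a_assoc) (auto simp: Pi_def)
  also have "(\<Oplus>i\<in>{..n}. U (Suc i)) \<oplus> U 0 = (\<Oplus>i\<in>{..Suc n}. U i)"
    by (subst finsum_Suc2) (auto simp: Pi_def)
  also have "\<dots> = (\<Oplus>i\<in>{..n}. U i)"
    by (simp add: finsum_Suc Pi_def U_end)
  also have "\<dots> = (\<Oplus>i\<in>{..n}. T n i \<otimes> b)"
    by (rule finsum_cong') (auto simp: Ub)
  also have "(\<Oplus>i\<in>{..n}. T n i \<otimes> a) \<oplus> (\<Oplus>i\<in>{..n}. T n i \<otimes> b) = (\<Oplus>i\<in>{..n}. T n i) \<otimes> (a \<oplus> b)"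
    by (simp add: finsum_ldistr r_distr Pi_def)
  also have "(\<Oplus>i\<in>{..n}. T n i) = (a \<oplus> b) [^] n"
    unfolding T_def using Suc.IH by simp
  finally show ?case
    by (simp add: T_def)
qed

lemma (in cring) add_pow_eq_zero_of_dvd:
  assumes "add_pow R p \<one> = \<zero>" "(p::nat) dvd m" "x \<in> carrier R"
  shows "add_pow R m x = \<zero>"
proof -
  obtain l where "m = p * l" using assms(2) by blast
  then have "add_pow R m \<one> = \<zero>"
    using assms(1) by (metis add.nat_pow_pow add.nat_pow_one one_closed)
  then show ?thesis
    using add_pow_ldistr[of \<one> x m] assms(3) by simp
qed

text \<open>All binomial coefficients strictly between the two ends are multiples of
  \<open>p\<close> and vanish in characteristic \<open>p\<close>.\<close>

lemma (in cring) frobenius_add: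
  fixes p :: nat
  assumes "Factorial_Ring.prime p" and char: "add_pow R p \<one> = \<zero>"
    and [simp]: "a \<in> carrier R" "b \<in> carrier R"
  shows "(a \<oplus> b) [^] p = a [^] p \<oplus> b [^] p"
proof -
  \<comment> \<open>In this form the inner indices are exactly the \<open>Suc i\<close> with
    \<open>i \<le> r\<close>, so both end terms can be split off.\<close>
  obtain r where p: "p = Suc (Suc r)"
    using assms(1) prime_ge_2_nat by (metis add_2_eq_Suc le_Suc_ex)
  define T where "T i = add_pow R (p choose i) (a [^] i \<otimes> b [^] (p - i))" for i
  have [simp]: "T i \<in> carrier R" for i by (simp add: T_def)
  have T0: "T (Suc i) = \<zero>" if "i \<le> r" for i
    unfolding T_def
    by (rule add_pow_eq_zero_of_dvd[OF char dvd_choose_prime]) (use that p assms(1) in auto)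
  have "(a \<oplus> b) [^] p = (\<Oplus>i\<in>{..Suc (Suc r)}. T i)"
    using binomial_expansion[of a b p] p unfolding T_def by simp
  also have "\<dots> = T p \<oplus> (\<Oplus>i\<in>{..Suc r}. T i)"
    by (simp add: finsum_Suc Pi_def p)
  also have "(\<Oplus>i\<in>{..Suc r}. T i) = (\<Oplus>i\<in>{..r}. T (Suc i)) \<oplus> T 0"
    by (subst finsum_Suc2) (auto simp: Pi_def)
  also have "(\<Oplus>i\<in>{..r}. T (Suc i)) = \<zero>"
    by (rule add.finprod_one_eqI) (simp add: T0)
  finally show ?thesis
    by (simp add: T_def)
qed

lemma (in cring) frobenius_power_add:
  fixes p :: nat
  assumes "Factorial_Ring.prime p" and "add_pow R p \<one> = \<zero>"
    and [simp]: "a \<in> carrier R" "b \<in> carrier R"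
  shows "(a \<oplus> b) [^] (p ^ d) = a [^] (p ^ d) \<oplus> b [^] (p ^ d)"
proof (induction d)
  case (Suc d)
  have "x [^] (p ^ Suc d) = (x [^] (p ^ d)) [^] p" if "x \<in> carrier R" for x
    using that by (simp add: nat_pow_pow mult.commute)
  then show ?case
    using Suc by (simp add: frobenius_add assms(1,2))
qed simp

text \<open>Additivity applied to \<open>\<ominus> a \<oplus> a\<close> settles the sign for odd and
  even \<open>p\<close> alike.\<close>

lemma (in cring) frobenius_power_minus:
  fixes p :: nat
  assumes "Factorial_Ring.prime p" and "add_pow R p \<one> = \<zero>" and [simp]: "a \<in> carrier R"
  shows "(\<ominus> a) [^] (p ^ d) = \<ominus> (a [^] (p ^ d))"
proof -
  have "(\<ominus> a) [^] (p ^ d) \<oplus> a [^] (p ^ d) = (\<ominus> a \<oplus> a) [^] (p ^ d)"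
    using frobenius_power_add[OF assms(1,2), of "\<ominus> a" a d] by simp
  also have "\<dots> = \<zero>"
    using assms(1) by (simp add: l_neg nat_pow_zero prime_gt_0_nat)
  finally show ?thesis
    by (metis minus_equality nat_pow_closed a_inv_closed assms(3))
qed

section \<open>Fixed points of Frobenius powers form a field of prime power order\<close>

lemma ring_hom_char:
  assumes "ring R" "ring S" "h \<in> ring_hom R S" "add_pow R (p::nat) \<one>\<^bsub>R\<^esub> = \<zero>\<^bsub>R\<^esub>"
  shows "add_pow S p \<one>\<^bsub>S\<^esub> = \<zero>\<^bsub>S\<^esub>"
proof -
  interpret h: ring_hom_ring R S h
    using assms(1-3) by (simp add: ring_hom_ringI2)
  have "h (add_pow R m \<one>\<^bsub>R\<^esub>) = add_pow S m \<one>\<^bsub>S\<^esub>" for m :: nat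
    by (induction m) (simp_all add: h.R.add.nat_pow_Suc h.S.add.nat_pow_Suc)
  from this[of p] show ?thesis
    using assms(4) by simp
qed


text \<open>The fixed points are the roots of \<open>X^q - X\<close>, which splits and has degree
  \<open>q\<close>, so it suffices that every root \<open>a\<close> is simple. Instead of a
  derivative, the Frobenius map of the polynomial ring is used: with \<open>u = X - a\<close> the
  polynomial equals \<open>u^q - u = u (u^(q-1) - 1)\<close>, and the second factor takes the value
  \<open>-1\<close> at \<open>a\<close>.\<close>

lemma (in algebraically_closed) card_frobenius_fixed_points:
  fixes p d :: nat
  assumes p: "Factorial_Ring.prime p" and char: "add_pow L p \<one> = \<zero>" and d: "d > 0"
  shows "finite {x \<in> carrier L. x [^] (p ^ d) = x}"
    and "card {x \<in> carrier L. x [^] (p ^ d) = x} = p ^ d"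
proof -
  define q where "q = p ^ d"
  have q2: "q \<ge> 2"
    using p d unfolding q_def by (metis prime_ge_2_nat self_le_power le_trans prime_ge_1_nat)
  let ?U = "poly_ring L"
  interpret UP: domain ?U
    using univ_poly_is_domain[OF carrier_is_subring] .
  have "poly_of_const \<in> ring_hom L ?U"
    using canonical_embedding_is_hom[OF carrier_is_subring] by simp
  \<comment> \<open>Characteristic \<open>p\<close> passes to the polynomial ring along the
    embedding of constants, so the Frobenius lemmas apply there too.\<close>
  then have charU: "add_pow ?U p \<one>\<^bsub>?U\<^esub> = \<zero>\<^bsub>?U\<^esub>"
    using ring_hom_char[OF ring_axioms UP.ring_axioms _ char] by blast
  have XU [simp]: "X \<in> carrier ?U"
    using var_closed(1)[OF carrier_is_subring] .
  define P where "P = X [^]\<^bsub>?U\<^esub> q \<ominus>\<^bsub>?U\<^esub> X"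
  have PU [simp]: "P \<in> carrier ?U"
    by (simp add: P_def)
  have degP: "degree P = q"
  proof -
    have "degree (X [^]\<^bsub>?U\<^esub> q) = q"
      using polynomial_pow_degree[OF XU, of q] by (simp add: var_def)
    moreover have "degree (\<ominus>\<^bsub>?U\<^esub> X) = 1"
      using univ_poly_a_inv_def'[OF carrier_is_subring XU] by (simp add: var_def)
    moreover have "P = poly_add (X [^]\<^bsub>?U\<^esub> q) (\<ominus>\<^bsub>?U\<^esub> X)"
      by (simp add: P_def a_minus_def univ_poly_add)
    ultimately show ?thesis
      using poly_add_degree_eq[OF carrier_is_subring, of "X [^]\<^bsub>?U\<^esub> q" "\<ominus>\<^bsub>?U\<^esub> X"] q2
      by (simp add: univ_poly_carrier)
  qed
  then have Pne: "P \<noteq> []"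
    using q2 by auto
  have is_root: "is_root P x \<longleftrightarrow> x \<in> carrier L \<and> x [^] q = x" for x
  proof (cases "x \<in> carrier L")
    case True
    interpret ev: ring_hom_cring ?U L "\<lambda>f. eval f x"
      using eval_cring_hom[OF carrier_is_subring True] .
    have "eval P x = x [^] q \<ominus> x"
      by (simp add: P_def a_minus_def True eval_var)
    then show ?thesis
      using True Pne by (simp add: is_root_def)
  qed (simp add: is_root_def)
  have simple: "alg_mult P a \<le> 1" for a
  proof (rule ccontr)
    assume "\<not> alg_mult P a \<le> 1"
    then have ge2: "2 \<le> alg_mult P a" by simp
    then have root: "is_root P a"
      using alg_mult_gt_zero_iff_is_root[OF PU, of a] by simp
    then have a [simp]: "a \<in> carrier L" and aq: "a [^] q = a"
      using is_root by auto
    define u where "u = [\<one>, \<ominus> a]"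
    define c where "c = poly_of_const a"
    have [simp]: "c \<in> carrier ?U"
      using \<open>poly_of_const \<in> ring_hom L ?U\<close> unfolding c_def by (rule ring_hom_closed) simp
    \<comment> \<open>The constant polynomial \<open>c\<close> inherits \<open>a^q = a\<close>,
      hence \<open>(X - c)^q = X^q - c\<close>.\<close>
    have cq: "c [^]\<^bsub>?U\<^esub> q = c"
    proof -
      interpret ce: ring_hom_ring L ?U poly_of_const
        using \<open>poly_of_const \<in> ring_hom L ?U\<close> ring_axioms UP.ring_axioms by (simp add: ring_hom_ringI2)
      show ?thesis
        unfolding c_def using ce.hom_nat_pow[OF a, of q] aq by simp
    qed
    have [simp]: "u \<in> carrier ?U"
      unfolding u_def sym[OF univ_poly_carrier] polynomial_def by auto
    have u: "u = X \<ominus>\<^bsub>?U\<^esub> c"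
    proof -
      interpret ce: ring_hom_ring L ?U poly_of_const
        using \<open>poly_of_const \<in> ring_hom L ?U\<close> ring_axioms UP.ring_axioms by (simp add: ring_hom_ringI2)
      have "X \<ominus>\<^bsub>?U\<^esub> c = poly_add [\<one>, \<zero>] (normalize [\<ominus> a])"
        unfolding c_def a_minus_def var_def
        using ce.hom_a_inv[OF a] by (simp add: poly_of_const_def univ_poly_add)
      then show ?thesis
        by (simp add: u_def)
    qed
    have "u [^]\<^bsub>?U\<^esub> q = X [^]\<^bsub>?U\<^esub> q \<ominus>\<^bsub>?U\<^esub> c"
      using UP.frobenius_power_add[OF p charU, of X "\<ominus>\<^bsub>?U\<^esub> c" d]
        UP.frobenius_power_minus[OF p charU, of c d] cq
      by (simp add: u a_minus_def q_def)
    \<comment> \<open>\<open>X^q - X\<close> is the difference of \<open>X^q - c\<close> and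
      \<open>X - c\<close>.\<close>
    then have "P = u [^]\<^bsub>?U\<^esub> q \<ominus>\<^bsub>?U\<^esub> u"
      unfolding P_def u by (simp add: a_minus_def UP.minus_add UP.a_ac UP.r_neg2)
    also have "u [^]\<^bsub>?U\<^esub> q = u \<otimes>\<^bsub>?U\<^esub> u [^]\<^bsub>?U\<^esub> (q - 1)"
      using q2 UP.nat_pow_Suc2[of u "q - 1"] by simp
    also have "\<dots> \<ominus>\<^bsub>?U\<^esub> u = u \<otimes>\<^bsub>?U\<^esub> (u [^]\<^bsub>?U\<^esub> (q - 1) \<ominus>\<^bsub>?U\<^esub> \<one>\<^bsub>?U\<^esub>)"
      by (simp add: a_minus_def UP.r_distr UP.r_minus)
    finally have Pu: "P = u \<otimes>\<^bsub>?U\<^esub> (u [^]\<^bsub>?U\<^esub> (q - 1) \<ominus>\<^bsub>?U\<^esub> \<one>\<^bsub>?U\<^esub>)" .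
    have "(u [^]\<^bsub>?U\<^esub> (2::nat)) pdivides P"
      using le_alg_mult_imp_pdivides[OF a PU ge2] by (simp add: u_def)
    then obtain r where r: "r \<in> carrier ?U" "P = u \<otimes>\<^bsub>?U\<^esub> u \<otimes>\<^bsub>?U\<^esub> r"
      by (auto simp: pdivides_def factor_def numeral_2_eq_2)
    have "u \<noteq> \<zero>\<^bsub>?U\<^esub>"
      by (simp add: u_def univ_poly_zero)
    then have *: "u [^]\<^bsub>?U\<^esub> (q - 1) \<ominus>\<^bsub>?U\<^esub> \<one>\<^bsub>?U\<^esub> = u \<otimes>\<^bsub>?U\<^esub> r"
      using Pu r by (simp add: UP.m_assoc UP.m_lcancel)
    interpret ev: ring_hom_cring ?U L "\<lambda>f. eval f a"
      using eval_cring_hom[OF carrier_is_subring a] .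
    have u0: "eval u a = \<zero>"
      using monic_degree_one_root_condition[OF a, of a] by (simp add: u_def is_root_def)
    \<comment> \<open>A multiple root would let \<open>u\<close> divide \<open>u^(q-1) - 1\<close>.
      Evaluation at \<open>a\<close> gives \<open>-1\<close> on one side, because
      \<open>q - 1 > 0\<close>, and \<open>0\<close> on the other.\<close>
    have "\<ominus> \<one> = eval (u [^]\<^bsub>?U\<^esub> (q - 1) \<ominus>\<^bsub>?U\<^esub> \<one>\<^bsub>?U\<^esub>) a"
      using q2 by (simp add: a_minus_def u0 nat_pow_zero)
    also have "\<dots> = \<zero>"
      unfolding * using r by (simp add: u0)
    finally show False
      by (metis one_closed one_not_zero minus_minus minus_zero)
  qed
  have count: "count (roots P) a \<le> 1" for a
    using simple[of a] alg_mult_eq_count_roots[OF PU] by simp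
  have set: "{x \<in> carrier L. x [^] q = x} = set_mset (roots P)"
    using roots_mem_iff_is_root[OF PU] is_root by auto
  \<comment> \<open>Since no root repeats, the number of distinct roots is the size of the multiset
    of roots, which is the degree because \<open>P\<close> splits.\<close>
  have "roots P = mset_set (set_mset (roots P))"
    by (rule multiset_eqI)
      (metis count count_mset_set(1,3) count_eq_zero_iff finite_set_mset le_antisym not_in_iff
        Suc_leI One_nat_def neq0_conv)
  then have "card (set_mset (roots P)) = size (roots P)"
    by (metis size_mset_set)
  also have "\<dots> = q"
    using roots_over_carrier[OF PU] degP by (simp add: splitted_def)
  finally show "card {x \<in> carrier L. x [^] (p ^ d) = x} = p ^ d" "finite {x \<in> carrier L. x [^] (p ^ d) = x}"
    using set by (simp_all add: q_def)
qed

lemma (in field) subfield_frobenius_fixed_points: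
  fixes p d :: nat
  assumes p: "Factorial_Ring.prime p" and char: "add_pow R p \<one> = \<zero>"
  shows "subfield {x \<in> carrier R. x [^] (p ^ d) = x} R"
proof (rule subfieldI')
  show "subring {x \<in> carrier R. x [^] (p ^ d) = x} R"
    by (rule subringI)
      (auto simp: frobenius_power_add[OF p char] frobenius_power_minus[OF p char] nat_pow_distrib)
next
  fix k assume k: "k \<in> {x \<in> carrier R. x [^] (p ^ d) = x} - {\<zero>}"
  then have "k \<in> Units R"
    by (simp add: field_Units)
  \<comment> \<open>The product of \<open>k = k^q\<close> and \<open>(inv k)^q\<close> is
    \<open>(k inv k)^q = 1\<close>, so \<open>(inv k)^q\<close> is the inverse of
    \<open>k\<close>.\<close>
  then show "inv k \<in> {x \<in> carrier R. x [^] (p ^ d) = x}"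
    using k nat_pow_distrib[of k "inv k" "p ^ d"] comm_inv_char[of k "inv k [^] (p ^ d)"] by simp
qed

lemma residue_ring_char:
  assumes "p > 1"
  shows "add_pow (residue_ring (int p)) p \<one>\<^bsub>residue_ring (int p)\<^esub> = \<zero>\<^bsub>residue_ring (int p)\<^esub>"
proof -
  have "add_pow (residue_ring (int p)) m \<one>\<^bsub>residue_ring (int p)\<^esub> = int m mod int p" for m :: nat
    by (induction m) (simp_all add: add_pow_def residue_ring_def nat_pow_def mod_add_right_eq add.commute)
  from this[of p] show ?thesis
    by (simp add: residue_ring_def)
qed

text \<open>The element type is that of the algebraic closure built over a residue ring of integers;
  its elements are indexed polynomials.\<close>

theorem finite_field_exists:
  assumes "primepow q"
  obtains F :: "((int list \<times> nat) multiset \<Rightarrow> int) ring"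
  where "field F" "finite (carrier F)" "card (carrier F) = q"
proof -
  obtain p d where p: "Factorial_Ring.prime p" and d: "d > 0" and q: "q = p ^ d"
    using assms by (auto simp: primepow_def)
  define K where "K = residue_ring (int p)"
  interpret K: residues_prime p K
    by unfold_locales (use p in \<open>simp_all add: K_def\<close>)
  interpret L: algebraic_closure K.alg_closure "K.indexed_const ` carrier K"
    by (rule K.alg_closureE(1))
  have char: "add_pow K.alg_closure p \<one>\<^bsub>K.alg_closure\<^esub> = \<zero>\<^bsub>K.alg_closure\<^esub>"
    using ring_hom_char[OF K.ring_axioms L.ring_axioms K.alg_closureE(2)]
      residue_ring_char[OF prime_gt_1_nat[OF p]] by (simp add: K_def)
  let ?S = "{x \<in> carrier K.alg_closure. x [^]\<^bsub>K.alg_closure\<^esub> (p ^ d) = x}"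
  have "field (K.alg_closure \<lparr>carrier := ?S\<rparr>)"
    using L.subfield_frobenius_fixed_points[OF p char] by (rule L.subfield_iff(2))
  then show ?thesis
    using L.card_frobenius_fixed_points[OF p char d] that q by auto
qed

section \<open>Bounds on the sum of maximum average degrees\<close>

lemma Mad_attained:
  assumes "is_graph G" "edges G \<noteq> {}"
  obtains H where "subgraph H G" "card (verts H) \<ge> 1"
    "Mad G = 2 * real (card (edges H)) / real (card (verts H))"
proof -
  have "Mad G \<in> {2 * real (card (edges H)) / real (card (verts H)) |H.
      subgraph H G \<and> card (verts H) \<ge> 1}"
    using Max_in[OF Mad_set_finite[OF assms(1)] Mad_set_nonempty[OF assms]] assms(2)
    by (simp only: Mad_def if_False)
  then show ?thesis
    using that by blast
qed

lemma Mad_ge: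
  assumes "is_graph G" "subgraph H G" "card (verts H) \<ge> 1"
  shows "2 * real (card (edges H)) / real (card (verts H)) \<le> Mad G"
proof (cases "edges G = {}")
  case True
  then show ?thesis
    using assms(2) by (simp add: Mad_def subgraph_def)
next
  case False
  then show ?thesis
    unfolding Mad_def if_not_P[OF False]
    by (intro Max_ge[OF Mad_set_finite[OF assms(1)]]) (use assms in blast)
qed

lemma card_edges_le:
  assumes "is_graph G"
  shows "card (edges G) \<le> card (verts G) choose 2"
proof -
  have "edges G \<subseteq> {e. e \<subseteq> verts G \<and> card e = 2}" "finite (verts G)"
    using assms by (auto simp: is_graph_def)
  then show ?thesis
    using card_mono[of "{e. e \<subseteq> verts G \<and> card e = 2}" "edges G"]
    by (simp add: n_subsets)
qed

lemma finite_edges: "is_graph G \<Longrightarrow> finite (edges G)"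
  by (rule finite_subset[of _ "Pow (verts G)"]) (auto simp: is_graph_def)

lemma real_choose_two: "2 * real (n choose 2) = real n * (real n - 1)"
  by (induction n) (simp_all add: numeral_2_eq_2 algebra_simps)

text \<open>For a densest subgraph with \<open>v\<close> vertices and average degree \<open>x \<le> v - 1\<close>, the right-hand side
  minus the left-hand side is at least \<open>(v - m) (v - m - 1)\<close>, unless \<open>v \<ge> 2 m\<close>, when the bound is
  trivial; integrality of \<open>v\<close> makes this product nonnegative.\<close>

lemma Mad_le_linear:
  assumes "is_graph G"
  shows "2 * real m * Mad G \<le> 2 * real (card (edges G)) + real m * (real m - 1)"
proof (cases "edges G = {}")
  case True
  then show ?thesis
    by (cases m) (simp_all add: Mad_def)
next
  case False
  then obtain H where H: "subgraph H G" "card (verts H) \<ge> 1"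
    "Mad G = 2 * real (card (edges H)) / real (card (verts H))"
    using Mad_attained[OF assms] by blast
  define v x where "v = real (card (verts H))" and "x = Mad G"
  have v: "v \<ge> 1" using H(2) by (simp add: v_def)
  have xv: "x * v = 2 * real (card (edges H))"
    using v by (simp add: x_def H(3) v_def)
  have "card (edges H) \<le> card (verts H) choose 2"
    using H(1) by (auto simp: subgraph_def card_edges_le)
  then have "x * v \<le> v * (v - 1)"
    using xv real_choose_two[of "card (verts H)"] by (simp add: v_def)
  then have x: "x \<le> v - 1"
    using v by (simp add: mult.commute)
  have x0: "x \<ge> 0"
    using v by (simp add: x_def H(3))
  have "x * v \<le> 2 * real (card (edges G))"
    unfolding xv using H(1) assms by (auto simp: subgraph_def intro!: card_mono finite_edges)
  moreover have "2 * real m * x \<le> x * v + real m * (real m - 1)"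
  proof (cases "v \<ge> 2 * real m")
    case True
    then have "2 * real m * x \<le> x * v"
      using x0 mult_right_mono[of "2 * real m" v x] by (simp add: mult.commute)
    moreover have "real m * (real m - 1) \<ge> 0"
      by (cases m) simp_all
    ultimately show ?thesis by linarith
  next
    case False
    have "0 \<le> (int (card (verts H)) - int m) * (int (card (verts H)) - int m - 1)"
      by (cases "int (card (verts H)) \<le> int m") (auto intro: mult_nonpos_nonpos)
    then have "0 \<le> real_of_int ((int (card (verts H)) - int m) * (int (card (verts H)) - int m - 1))"
      by (simp only: of_int_0_le_iff)
    then have "0 \<le> (v - real m) * (v - real m - 1)"
      by (simp add: v_def)
    also have "\<dots> = real m * (real m - 1) - (2 * real m - v) * (v - 1)"
      by (simp add: algebra_simps)
    finally have "(2 * real m - v) * (v - 1) \<le> real m * (real m - 1)" by simp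
    \<comment> \<open>The factor \<open>2 m - v\<close> is positive in this case, so
      \<open>x\<close> may be replaced by its upper bound \<open>v - 1\<close>.\<close>
    moreover have "(2 * real m - v) * x \<le> (2 * real m - v) * (v - 1)"
      using False x by (intro mult_left_mono) auto
    ultimately show ?thesis
      by (simp add: algebra_simps)
  qed
  ultimately show ?thesis
    by (simp add: x_def)
qed

lemma M_le_linear:
  assumes "k \<ge> 1"
  shows "2 * real m * M k n \<le> real n * (real n - 1) + real k * (real m * (real m - 1))"
proof -
  obtain G where G: "edge_partition k n G" and MG: "M k n = (\<Sum>i=1..k. Mad (G i))"
    using Max_in[OF M_set_finite M_set_nonempty[OF assms], of n] by (auto simp: M_def)
  have graph: "is_graph (G i)" if "i \<in> {1..k}" for i
    using G that by (auto simp: edge_partition_def spanning_subgraph_def subgraph_def)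
  \<comment> \<open>Of the optimal partition only the total number of edges enters the
    bound.\<close>
  have "(\<Sum>i=1..k. card (edges (G i))) = card (\<Union>i\<in>{1..k}. edges (G i))"
    using G graph by (subst card_UN_disjoint)
      (auto simp: edge_partition_def disjoint_family_on_def finite_edges)
  also have "\<dots> = n choose 2"
    using G by (simp add: edge_partition_def complete_graph_def n_subsets)
  finally have card: "(\<Sum>i=1..k. real (card (edges (G i)))) = real (n choose 2)"
    by (simp only: of_nat_sum[symmetric])
  have "2 * real m * M k n = (\<Sum>i=1..k. 2 * real m * Mad (G i))"
    by (simp add: MG sum_distrib_left)
  also have "\<dots> \<le> (\<Sum>i=1..k. 2 * real (card (edges (G i))) + real m * (real m - 1))"
    by (intro sum_mono Mad_le_linear graph)
  also have "\<dots> = 2 * (\<Sum>i=1..k. real (card (edges (G i)))) + real k * (real m * (real m - 1))"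
    by (simp add: sum.distrib sum_distrib_left)
  finally show ?thesis
    unfolding card by (simp add: real_choose_two)
qed

section \<open>From linear spaces to edge partitions\<close>

lemma Mad_complete:
  assumes "finite V" "W \<subseteq> V"
  shows "real (card W - 1) \<le> Mad (V, {e. e \<subseteq> W \<and> card e = 2})"
proof (cases "card W = 0")
  \<comment> \<open>For empty \<open>W\<close> the truncated \<open>card W - 1\<close> is 0, as is
    \<open>Mad\<close> of an edgeless graph.\<close>
  case True
  moreover have "finite W"
    using assms finite_subset by blast
  ultimately have "{e. e \<subseteq> W \<and> card e = 2} = {}"
    using assms by auto
  then show ?thesis
    using True by (simp add: Mad_def)
next
  case False
  have "real (card W - 1) = 2 * real (card W choose 2) / real (card W)"
    using False by (simp add: real_choose_two of_nat_diff)
  also have "\<dots> \<le> Mad (V, {e. e \<subseteq> W \<and> card e = 2})"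
    using Mad_ge[of "(V, {e. e \<subseteq> W \<and> card e = 2})" "(W, {e. e \<subseteq> W \<and> card e = 2})"]
      False assms finite_subset[OF assms(2,1)]
    by (auto simp: is_graph_def subgraph_def n_subsets)
  finally show ?thesis .
qed

text \<open>Each block spans a clique; existence of a block through every pair makes the cliques
  cover all edges, uniqueness makes them edge-disjoint. Blocks enter through
  \<open>B i \<inter> V\<close>, so that the lines of a full plane also serve after points are
  deleted.\<close>

lemma M_ge_sum_blocks:
  fixes V :: "'a set" and I :: "'b set" and B :: "'b \<Rightarrow> 'a set"
  assumes "finite V" "card V = n" "finite I" "card I = k"
    and pairs: "\<And>x y. x \<in> V \<Longrightarrow> y \<in> V \<Longrightarrow> x \<noteq> y \<Longrightarrow> \<exists>!i. i \<in> I \<and> x \<in> B i \<and> y \<in> B i"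
  shows "(\<Sum>i\<in>I. real (card (B i \<inter> V) - 1)) \<le> M k n"
proof -
  obtain f where f: "bij_betw f {1..n} V"
    using assms(1,2) by (metis finite_same_card_bij finite_atLeastAtMost card_atLeastAtMost diff_Suc_1)
  obtain g where g: "bij_betw g {1..k} I"
    using assms(3,4) by (metis finite_same_card_bij finite_atLeastAtMost card_atLeastAtMost diff_Suc_1)
  \<comment> \<open>\<open>M\<close> speaks of vertices \<open>{1..n}\<close> and indices
    \<open>{1..k}\<close>, so points and blocks are transported there along \<open>f\<close> and
    \<open>g\<close>.\<close>
  define W where "W j = {x \<in> {1..n}. f x \<in> B (g j)}" for j
  define G :: "nat \<Rightarrow> nat graph" where "G j = ({1..n}, {e. e \<subseteq> W j \<and> card e = 2})" for j
  have W_sub: "W j \<subseteq> {1..n}" for j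
    by (auto simp: W_def)
  have unique: "\<exists>!j. j \<in> {1..k} \<and> e \<subseteq> W j" if e: "e \<subseteq> {1..n}" "card e = 2" for e
  proof -
    obtain x y where xy: "e = {x, y}" "x \<noteq> y"
      using e(2) by (meson card_2_iff)
    then have xyn: "x \<in> {1..n}" "y \<in> {1..n}"
      using e(1) by auto
    have "f x \<noteq> f y"
      using xy(2) xyn inj_onD[OF bij_betw_imp_inj_on[OF f]] by blast
    from pairs[OF bij_betw_apply[OF f xyn(1)] bij_betw_apply[OF f xyn(2)] this]
    obtain i where i: "i \<in> I" "f x \<in> B i" "f y \<in> B i"
      and i_unique: "\<And>i'. i' \<in> I \<Longrightarrow> f x \<in> B i' \<Longrightarrow> f y \<in> B i' \<Longrightarrow> i' = i"
      by blast
    obtain j where j: "j \<in> {1..k}" "g j = i"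
      using g i(1) by (auto simp: bij_betw_def)
    show ?thesis
    proof (intro ex1I[of _ j] conjI)
      show "e \<subseteq> W j"
        using xy e(1) i j by (auto simp: W_def)
      fix j' assume j': "j' \<in> {1..k} \<and> e \<subseteq> W j'"
      then have "g j' = i"
        using xy bij_betw_apply[OF g] by (intro i_unique) (auto simp: W_def)
      then show "j' = j"
        using j j' inj_onD[OF bij_betw_imp_inj_on[OF g]] by blast
    qed (use j in simp)
  qed
  have "edge_partition k n G"
    unfolding edge_partition_def
  proof (intro conjI ballI)
    show "spanning_subgraph (G j) (complete_graph n)" for j
      using W_sub[of j]
      by (auto simp: spanning_subgraph_def subgraph_def is_graph_def complete_graph_def G_def)
    show "disjoint_family_on (\<lambda>j. edges (G j)) {1..k}"
      unfolding disjoint_family_on_def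
    proof (intro ballI impI)
      fix j j' assume j: "j \<in> {1..k}" "j' \<in> {1..k}" "j \<noteq> j'"
      have False if "e \<in> edges (G j)" "e \<in> edges (G j')" for e
      proof -
        have e: "e \<subseteq> {1..n}" "card e = 2" "e \<subseteq> W j" "e \<subseteq> W j'"
          using that W_sub[of j] by (auto simp: G_def)
        then show False
          using unique[OF e(1,2)] j by blast
      qed
      then show "edges (G j) \<inter> edges (G j') = {}" by blast
    qed
    show "(\<Union>j\<in>{1..k}. edges (G j)) = edges (complete_graph n)"
    proof
      show "(\<Union>j\<in>{1..k}. edges (G j)) \<subseteq> edges (complete_graph n)"
        using W_sub by (auto simp: G_def complete_graph_def)
      show "edges (complete_graph n) \<subseteq> (\<Union>j\<in>{1..k}. edges (G j))"
      proof
        fix e assume "e \<in> edges (complete_graph n)"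
        then have e: "e \<subseteq> {1..n}" "card e = 2"
          by (auto simp: complete_graph_def)
        then show "e \<in> (\<Union>j\<in>{1..k}. edges (G j))"
          using unique[OF e] by (auto simp: G_def)
      qed
    qed
  qed
  then have M: "(\<Sum>j=1..k. Mad (G j)) \<le> M k n"
    unfolding M_def by (intro Max_ge[OF M_set_finite]) auto
  have cardW: "card (W j) = card (B (g j) \<inter> V)" for j
  proof -
    have "f ` W j = B (g j) \<inter> V"
      using f by (auto simp: W_def bij_betw_def)
    moreover have "inj_on f (W j)"
      using f W_sub[of j] by (auto simp: bij_betw_def intro: inj_on_subset)
    ultimately show ?thesis
      by (metis card_image)
  qed
  have "(\<Sum>i\<in>I. real (card (B i \<inter> V) - 1)) = (\<Sum>j=1..k. real (card (W j) - 1))"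
    unfolding cardW using sum.reindex_bij_betw[OF g, of "\<lambda>i. real (card (B i \<inter> V) - 1)"] by simp
  also have "\<dots> \<le> (\<Sum>j=1..k. Mad (G j))"
    unfolding G_def by (intro sum_mono Mad_complete W_sub finite_atLeastAtMost)
  finally show ?thesis
    using M by linarith
qed

text \<open>\<open>S\<close> is a known lower bound, and the last hypothesis says that the linear
  upper bound with parameter \<open>m\<close> equals \<open>2 m S\<close>; cancelling
  \<open>2 m\<close> closes the gap.\<close>

lemma M_eqI:
  assumes "k \<ge> 1" "m \<ge> 1" "S \<le> M k n"
    and "real n * (real n - 1) + real k * (real m * (real m - 1)) = 2 * real m * S"
  shows "M k n = S"
proof -
  have "2 * real m * M k n \<le> 2 * real m * S"
    using M_le_linear[OF assms(1), of m n] assms(4) by simp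
  then have "M k n \<le> S"
    using assms(2) by simp
  with assms(3) show ?thesis by simp
qed

section \<open>Affine and projective planes\<close>

lemma (in cring) add_eq_iff_eq_minus:
  assumes "a \<in> carrier R" "b \<in> carrier R" "y \<in> carrier R"
  shows "a \<oplus> b = y \<longleftrightarrow> b = y \<ominus> a"
proof
  assume "a \<oplus> b = y"
  then show "b = y \<ominus> a"
    using assms by (metis a_closed a_comm a_inv_closed a_minus_def r_neg1)
next
  assume "b = y \<ominus> a"
  then show "a \<oplus> b = y"
    using assms by (metis a_comm a_inv_closed a_minus_def minus_closed r_neg2)
qed

text \<open>Eliminating \<open>b\<close> leaves \<open>m (x - x') = y - y'\<close>, where
  \<open>x - x'\<close> is a unit. The equivalence yields existence and uniqueness of the joining
  line at once.\<close>

lemma (in field) line_through_two_points_iff: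
  assumes [simp]: "x \<in> carrier R" "x' \<in> carrier R" "y \<in> carrier R" "y' \<in> carrier R"
      "m \<in> carrier R" "b \<in> carrier R"
    and "x \<noteq> x'"
  shows "m \<otimes> x \<oplus> b = y \<and> m \<otimes> x' \<oplus> b = y' \<longleftrightarrow>
    m = (y \<ominus> y') \<otimes> inv (x \<ominus> x') \<and> b = y \<ominus> m \<otimes> x"
proof -
  have "x \<ominus> x' \<noteq> \<zero>"
    using \<open>x \<noteq> x'\<close> by simp
  then have unit: "x \<ominus> x' \<in> Units R"
    by (simp add: field_Units)
  have "m \<otimes> x' \<oplus> b = y' \<longleftrightarrow> m = (y \<ominus> y') \<otimes> inv (x \<ominus> x')" if b: "b = y \<ominus> m \<otimes> x"
  proof -
    have "m \<otimes> x' \<oplus> b = y \<ominus> m \<otimes> (x \<ominus> x')"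
      by (simp add: b a_minus_def r_distr r_minus minus_add a_ac)
    then have "m \<otimes> x' \<oplus> b = y' \<longleftrightarrow> y \<ominus> m \<otimes> (x \<ominus> x') = y'"
      by simp
    also have "\<dots> \<longleftrightarrow> m \<otimes> (x \<ominus> x') = y \<ominus> y'"
      using add_eq_iff_eq_minus[of "m \<otimes> (x \<ominus> x')" y' y] add_eq_iff_eq_minus[of y' "m \<otimes> (x \<ominus> x')" y]
      by (auto simp: a_comm)
    also have "\<dots> \<longleftrightarrow> m = (y \<ominus> y') \<otimes> inv (x \<ominus> x')"
      using unit m_assoc[of m "x \<ominus> x'" "inv (x \<ominus> x')"] m_assoc[of "y \<ominus> y'" "inv (x \<ominus> x')" "x \<ominus> x'"]
      by (metis Units_inv_closed Units_l_inv Units_r_inv assms(1-5) minus_closed r_one)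
    finally show ?thesis .
  qed
  then show ?thesis
    using add_eq_iff_eq_minus[of "m \<otimes> x" b y] by auto
qed

text \<open>\<open>Inl (m, b)\<close> names the line \<open>y = m x + b\<close> and \<open>Inr c\<close> the line \<open>x = c\<close>;
  the slope \<open>None\<close> is the vertical one.\<close>

fun affine_line :: "('a, 'c) ring_scheme \<Rightarrow> 'a \<times> 'a + 'a \<Rightarrow> ('a \<times> 'a) set" where
  "affine_line R (Inl (m, b)) = (\<lambda>x. (x, m \<otimes>\<^bsub>R\<^esub> x \<oplus>\<^bsub>R\<^esub> b)) ` carrier R"
| "affine_line R (Inr c) = {c} \<times> carrier R"

definition affine_lines :: "('a, 'c) ring_scheme \<Rightarrow> ('a \<times> 'a + 'a) set" where
  "affine_lines R = Sum_Type.Plus (carrier R \<times> carrier R) (carrier R)"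

fun slope :: "'a \<times> 'a + 'a \<Rightarrow> 'a option" where
  "slope (Inl (m, b)) = Some m"
| "slope (Inr c) = None"

definition slopes :: "('a, 'c) ring_scheme \<Rightarrow> 'a option set" where
  "slopes R = insert None (Some ` carrier R)"

text \<open>\<open>None\<close> names the line at infinity, whose points \<open>Inr s\<close> are the slopes.\<close>

fun projective_line ::
  "('a, 'c) ring_scheme \<Rightarrow> ('a \<times> 'a + 'a) option \<Rightarrow> (('a \<times> 'a) + 'a option) set" where
  "projective_line R None = Inr ` slopes R"
| "projective_line R (Some l) = insert (Inr (slope l)) (Inl ` affine_line R l)"

text \<open>A nonvertical line is the graph of a function, so distinct points with equal first
  coordinate share only a vertical line. In all other cases slope and intercept are forced.\<close>

lemma (in field) ex1_affine_line_two_points: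
  assumes P: "P \<in> carrier R \<times> carrier R" "Q \<in> carrier R \<times> carrier R" "P \<noteq> Q"
  shows "\<exists>!l. l \<in> affine_lines R \<and> P \<in> affine_line R l \<and> Q \<in> affine_line R l"
proof -
  obtain x y x' y' where PQ: "P = (x, y)" "Q = (x', y')"
    by fastforce
  then have xy: "x \<in> carrier R" "y \<in> carrier R" "x' \<in> carrier R" "y' \<in> carrier R"
    using P by auto
  show ?thesis
  proof (cases "x = x'")
    case True
    then have "y \<noteq> y'" using P(3) PQ by auto
    then show ?thesis
      using True xy by (intro ex1I[of _ "Inr x"]) (auto simp: PQ affine_lines_def)
  next
    case False
    let ?m = "(y \<ominus> y') \<otimes> inv (x \<ominus> x')"
    let ?b = "y \<ominus> ?m \<otimes> x"
    have "x \<ominus> x' \<in> Units R"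
      using False xy by (simp add: field_Units)
    then have mb: "?m \<in> carrier R" "?b \<in> carrier R"
      using xy by simp_all
    show ?thesis
    proof (rule ex1I[of _ "Inl (?m, ?b)"])
      show "Inl (?m, ?b) \<in> affine_lines R \<and> P \<in> affine_line R (Inl (?m, ?b)) \<and>
          Q \<in> affine_line R (Inl (?m, ?b))"
        using line_through_two_points_iff[OF xy(1,3,2,4) mb False] xy mb
        by (auto simp: PQ affine_lines_def image_iff)
    next
      fix l assume l: "l \<in> affine_lines R \<and> P \<in> affine_line R l \<and> Q \<in> affine_line R l"
      show "l = Inl (?m, ?b)"
      proof (cases l)
        case (Inl mb)
        then obtain m b where "l = Inl (m, b)" by (cases mb) auto
        with l show ?thesis
          using line_through_two_points_iff[OF xy(1,3,2,4), of m b] False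
          by (auto simp: PQ affine_lines_def)
      next
        case (Inr c)
        then show ?thesis using l False by (auto simp: PQ)
      qed
    qed
  qed
qed

text \<open>This is the parallel postulate: the lines of one slope partition the plane. It joins an
  affine point to a point at infinity.\<close>

lemma (in field) ex1_affine_line_slope:
  assumes P: "P \<in> carrier R \<times> carrier R" and s: "s \<in> slopes R"
  shows "\<exists>!l. l \<in> affine_lines R \<and> P \<in> affine_line R l \<and> slope l = s"
proof -
  obtain x y where xy: "P = (x, y)" "x \<in> carrier R" "y \<in> carrier R"
    using P by auto
  show ?thesis
  proof (cases s)
    case None
    have "l = Inr x" if "P \<in> affine_line R l" "slope l = None" for l
      using that xy by (cases l) auto
    then show ?thesis
      using xy None by (intro ex1I[of _ "Inr x"]) (auto simp: affine_lines_def)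
  next
    case (Some m)
    then have m: "m \<in> carrier R"
      using s by (auto simp: slopes_def)
    have "l = Inl (m, y \<ominus> m \<otimes> x)"
      if l: "l \<in> affine_lines R" "P \<in> affine_line R l" "slope l = Some m" for l
    proof -
      obtain b where "l = Inl (m, b)" "b \<in> carrier R" "m \<otimes> x \<oplus> b = y"
        using l xy by (cases l) (auto simp: affine_lines_def)
      then show ?thesis
        using xy m add_eq_iff_eq_minus[of "m \<otimes> x" b y] by simp
    qed
    moreover have "m \<otimes> x \<oplus> (y \<ominus> m \<otimes> x) = y"
      using xy m add_eq_iff_eq_minus[of "m \<otimes> x" "y \<ominus> m \<otimes> x" y] by simp
    ultimately show ?thesis
      using xy m Some by (intro ex1I[of _ "Inl (m, y \<ominus> m \<otimes> x)"]) (auto simp: affine_lines_def)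
  qed
qed

lemma slope_in_slopes: "l \<in> affine_lines R \<Longrightarrow> slope l \<in> slopes R"
  by (auto simp: affine_lines_def slopes_def)

text \<open>Two affine points are joined by their affine line, an affine point and a slope by the
  parallel postulate. Two slopes lie only on the line at infinity, because an affine line carries a
  single slope.\<close>

lemma (in field) ex1_projective_line_two_points:
  assumes P: "P \<in> Sum_Type.Plus (carrier R \<times> carrier R) (slopes R)"
    and Q: "Q \<in> Sum_Type.Plus (carrier R \<times> carrier R) (slopes R)" and "P \<noteq> Q"
  shows "\<exists>!l. l \<in> insert None (Some ` affine_lines R) \<and>
    P \<in> projective_line R l \<and> Q \<in> projective_line R l"
proof -
  have mixed: "\<exists>!l. l \<in> insert None (Some ` affine_lines R) \<and>
      Inl A \<in> projective_line R l \<and> Inr s \<in> projective_line R l"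
    if A: "A \<in> carrier R \<times> carrier R" and s: "s \<in> slopes R" for A s
  proof -
    obtain l where l: "l \<in> affine_lines R" "A \<in> affine_line R l" "slope l = s"
      and uniq: "\<And>l'. l' \<in> affine_lines R \<Longrightarrow> A \<in> affine_line R l' \<Longrightarrow> slope l' = s \<Longrightarrow> l' = l"
      using ex1_affine_line_slope[OF A s] by blast
    show ?thesis
    proof (rule ex1I[of _ "Some l"])
      fix l'' assume "l'' \<in> insert None (Some ` affine_lines R) \<and>
        Inl A \<in> projective_line R l'' \<and> Inr s \<in> projective_line R l''"
      then obtain l' where "l'' = Some l'" "l' \<in> affine_lines R" "A \<in> affine_line R l'" "slope l' = s"
        by auto
      then show "l'' = Some l"
        using uniq by blast
    qed (use l in auto)
  qed
  consider (aa) A B where "P = Inl A" "Q = Inl B" "A \<in> carrier R \<times> carrier R"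
      "B \<in> carrier R \<times> carrier R" "A \<noteq> B"
    | (as) A s where "P = Inl A" "Q = Inr s" "A \<in> carrier R \<times> carrier R" "s \<in> slopes R"
    | (sa) s B where "P = Inr s" "Q = Inl B" "B \<in> carrier R \<times> carrier R" "s \<in> slopes R"
    | (ss) s t where "P = Inr s" "Q = Inr t" "s \<in> slopes R" "t \<in> slopes R" "s \<noteq> t"
    by (cases P; cases Q) (use assms in auto)
  then show ?thesis
  proof cases
    case aa
    then obtain l where l: "l \<in> affine_lines R" "A \<in> affine_line R l" "B \<in> affine_line R l"
      and uniq: "\<And>l'. l' \<in> affine_lines R \<Longrightarrow> A \<in> affine_line R l' \<Longrightarrow> B \<in> affine_line R l' \<Longrightarrow> l' = l"
      using ex1_affine_line_two_points by metis
    show ?thesis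
    proof (rule ex1I[of _ "Some l"])
      fix l'' assume "l'' \<in> insert None (Some ` affine_lines R) \<and>
        P \<in> projective_line R l'' \<and> Q \<in> projective_line R l''"
      then obtain l' where "l'' = Some l'" "l' \<in> affine_lines R" "A \<in> affine_line R l'" "B \<in> affine_line R l'"
        using aa by auto
      then show "l'' = Some l"
        using uniq by blast
    qed (use aa l in auto)
  next
    case as
    show ?thesis unfolding as(1,2) by (rule mixed[OF as(3,4)])
  next
    case sa
    show ?thesis unfolding sa(1,2) using mixed[OF sa(3,4)] by blast
  next
    case ss
    then show ?thesis by (intro ex1I[of _ None]) auto
  qed
qed

section \<open>Counting points and lines\<close>

lemma card_affine_line:
  assumes "l \<in> affine_lines R"
  shows "card (affine_line R l) = card (carrier R)"
  using assms by (auto simp: affine_lines_def card_image inj_on_def card_cartesian_product)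

lemma finite_affine_line: "finite (carrier R) \<Longrightarrow> finite (affine_line R l)"
  by (cases "(R, l)" rule: affine_line.cases) auto

lemma (in field) affine_line_subset:
  "l \<in> affine_lines R \<Longrightarrow> affine_line R l \<subseteq> carrier R \<times> carrier R"
  by (auto simp: affine_lines_def)

lemma card_affine_lines:
  "finite (carrier R) \<Longrightarrow> card (affine_lines R) = card (carrier R) ^ 2 + card (carrier R)"
  by (simp add: affine_lines_def card_Plus card_cartesian_product power2_eq_square)

lemma finite_affine_lines: "finite (carrier R) \<Longrightarrow> finite (affine_lines R)"
  by (simp add: affine_lines_def)

lemma card_slopes: "finite (carrier R) \<Longrightarrow> card (slopes R) = card (carrier R) + 1"
  by (simp add: slopes_def card_image card_insert_disjoint image_iff)

context field
begin

context
  fixes q :: nat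
  assumes fin: "finite (carrier R)" and q: "card (carrier R) = q"
begin

lemma card_carrier_ge_2: "q \<ge> 2"
proof -
  have "card {\<zero>, \<one>} \<le> card (carrier R)"
    using fin by (intro card_mono) auto
  then show ?thesis
    using q by simp
qed

text \<open>Vertical and nonvertical lines are separated because the deletions below affect them
  differently.\<close>

lemma sum_affine_lines:
  fixes f :: "_ \<Rightarrow> real"
  shows "(\<Sum>l\<in>affine_lines R. f l) =
    (\<Sum>(m, b)\<in>carrier R \<times> carrier R. f (Inl (m, b))) + (\<Sum>c\<in>carrier R. f (Inr c))"
  using fin by (simp add: affine_lines_def sum.Plus comp_def case_prod_unfold)

lemma card_projective_points: "card (Sum_Type.Plus (carrier R \<times> carrier R) (slopes R)) = q\<^sup>2 + q + 1"
  using fin q by (simp add: card_Plus card_cartesian_product card_slopes card_image power2_eq_square slopes_def)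

lemma card_projective_line:
  assumes "l \<in> insert None (Some ` affine_lines R)"
  shows "card (projective_line R l) = q + 1"
  using assms fin q
  by (auto simp: card_image card_slopes card_affine_line finite_affine_line card_insert_if image_iff)

lemma projective_line_subset:
  assumes "l \<in> insert None (Some ` affine_lines R)"
  shows "projective_line R l \<subseteq> Sum_Type.Plus (carrier R \<times> carrier R) (slopes R)"
  using assms affine_line_subset slope_in_slopes by fastforce

section \<open>Lower bounds from the five linear spaces\<close>

lemma M_ge_projective_plane: "real q * real (q\<^sup>2 + q + 1) \<le> M (q\<^sup>2 + q + 1) (q\<^sup>2 + q + 1)"
proof -
  let ?V = "Sum_Type.Plus (carrier R \<times> carrier R) (slopes R)"
  let ?I = "insert None (Some ` affine_lines R)"
  have I: "finite ?I" "card ?I = q\<^sup>2 + q + 1"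
    using fin q by (auto simp: finite_affine_lines card_affine_lines card_image card_insert_if)
  have "(\<Sum>l\<in>?I. real (card (projective_line R l \<inter> ?V) - 1)) \<le> M (q\<^sup>2 + q + 1) (q\<^sup>2 + q + 1)"
    by (rule M_ge_sum_blocks)
      (use fin I card_projective_points ex1_projective_line_two_points in \<open>auto simp: slopes_def\<close>)
  also have "(\<Sum>l\<in>?I. real (card (projective_line R l \<inter> ?V) - 1)) = (\<Sum>l\<in>?I. real q)"
    by (intro sum.cong refl)
      (simp only: Int_absorb2[OF projective_line_subset] card_projective_line diff_add_inverse2)
  finally show ?thesis
    by (simp only: sum_constant I(2) mult.commute)
qed

lemma M_ge_affine_plane: "real (q - 1) * real (q\<^sup>2 + q) \<le> M (q\<^sup>2 + q) (q\<^sup>2)"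
proof -
  let ?V = "carrier R \<times> carrier R"
  have I: "finite (affine_lines R)" "card (affine_lines R) = q\<^sup>2 + q"
    using fin q by (auto simp: finite_affine_lines card_affine_lines)
  have "(\<Sum>l\<in>affine_lines R. real (card (affine_line R l \<inter> ?V) - 1)) \<le> M (q\<^sup>2 + q) (q\<^sup>2)"
    by (rule M_ge_sum_blocks[OF _ _ I ex1_affine_line_two_points])
      (use fin q in \<open>simp_all add: card_cartesian_product power2_eq_square\<close>)
  also have "(\<Sum>l\<in>affine_lines R. real (card (affine_line R l \<inter> ?V) - 1)) =
      (\<Sum>l\<in>affine_lines R. real (q - 1))"
    by (intro sum.cong refl) (simp only: Int_absorb2[OF affine_line_subset] card_affine_line q)
  finally show ?thesis
    by (simp only: sum_constant I(2) mult.commute)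
qed

text \<open>The deleted point is the vertical direction \<open>Inr None\<close>. The line at
  infinity and the \<open>q\<close> vertical lines drop to \<open>q\<close> points, the other
  \<open>q^2\<close> lines keep \<open>q + 1\<close>, giving
  \<open>(q + 1)(q - 1) + q^3\<close>.\<close>

lemma M_ge_projective_plane_minus_point:
  "real q ^ 3 + real q ^ 2 - 1 \<le> M (q\<^sup>2 + q + 1) (q\<^sup>2 + q)"
proof -
  let ?P = "Sum_Type.Plus (carrier R \<times> carrier R) (slopes R)"
  let ?V = "?P - {Inr None}"
  let ?I = "insert None (Some ` affine_lines R)"
  let ?f = "\<lambda>l. real (card (projective_line R l \<inter> ?V) - 1)"
  have I: "finite ?I" "card ?I = q\<^sup>2 + q + 1"
    using fin q by (auto simp: finite_affine_lines card_affine_lines card_image card_insert_if)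
  have V: "finite ?V" "card ?V = q\<^sup>2 + q"
    using card_projective_points fin by (auto simp: card_Diff_singleton_if slopes_def)
  have "(\<Sum>l\<in>?I. ?f l) \<le> M (q\<^sup>2 + q + 1) (q\<^sup>2 + q)"
    by (rule M_ge_sum_blocks[OF V I ex1_projective_line_two_points]) auto
  moreover have "(\<Sum>l\<in>?I. ?f l) = ?f None + (\<Sum>l\<in>affine_lines R. ?f (Some l))"
    using fin by (simp add: finite_affine_lines sum.reindex image_iff)
  moreover have card: "card (projective_line R l \<inter> ?V) =
      (if Inr None \<in> projective_line R l then q else q + 1)" if "l \<in> ?I" for l
  proof -
    have "projective_line R l \<inter> ?V = projective_line R l - {Inr None}"
      using projective_line_subset[OF that] by auto
    then show ?thesis
      using card_projective_line[OF that] by (simp add: card_Diff_singleton_if)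
  qed
  moreover have "?f None = real q - 1"
    using card[of None] card_carrier_ge_2 by (simp add: slopes_def of_nat_diff)
  moreover have "(\<Sum>l\<in>affine_lines R. ?f (Some l)) =
      (\<Sum>(m, b)\<in>carrier R \<times> carrier R. real q) + (\<Sum>c\<in>carrier R. real q - 1)"
    unfolding sum_affine_lines
  proof (intro arg_cong2[where f = "(+)"] sum.cong refl, clarify)
    fix m b assume "m \<in> carrier R" "b \<in> carrier R"
    then have "Some (Inl (m, b)) \<in> ?I"
      by (auto simp: affine_lines_def)
    from card[OF this] show "?f (Some (Inl (m, b))) = real q"
      by auto
  next
    fix c assume "c \<in> carrier R"
    then have "Some (Inr c) \<in> ?I"
      by (auto simp: affine_lines_def)
    from card[OF this] show "?f (Some (Inr c)) = real q - 1"
      using card_carrier_ge_2 by (auto simp: of_nat_diff)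
  qed
  ultimately show ?thesis
    using q by (simp add: card_cartesian_product algebra_simps power2_eq_square power3_eq_cube)
qed

text \<open>The origin is deleted. In each of the \<open>q + 1\<close> parallel classes exactly one
  line passes through it and drops to \<open>q - 1\<close> points, so each class contributes
  \<open>q (q - 1) - 1\<close>.\<close>

lemma M_ge_affine_plane_minus_point:
  "real q ^ 3 - 2 * real q - 1 \<le> M (q\<^sup>2 + q) (q\<^sup>2 - 1)"
proof -
  let ?V = "carrier R \<times> carrier R - {(\<zero>, \<zero>)}"
  let ?f = "\<lambda>l. real (card (affine_line R l \<inter> ?V) - 1)"
  have I: "finite (affine_lines R)" "card (affine_lines R) = q\<^sup>2 + q"
    using fin q by (auto simp: finite_affine_lines card_affine_lines)
  have V: "finite ?V" "card ?V = q\<^sup>2 - 1"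
    using fin q by (auto simp: card_Diff_singleton card_cartesian_product power2_eq_square)
  have le: "(\<Sum>l\<in>affine_lines R. ?f l) \<le> M (q\<^sup>2 + q) (q\<^sup>2 - 1)"
    by (rule M_ge_sum_blocks[OF V I ex1_affine_line_two_points]) auto
  have card: "?f l = (if (\<zero>, \<zero>) \<in> affine_line R l then real q - 2 else real q - 1)"
    if "l \<in> affine_lines R" for l
  proof -
    have "affine_line R l \<inter> ?V = affine_line R l - {(\<zero>, \<zero>)}"
      using affine_line_subset[OF that] by auto
    then show ?thesis
      using card_affine_line[OF that] q card_carrier_ge_2 by (simp add: card_Diff_singleton_if of_nat_diff)
  qed
  have origin: "(\<zero>, \<zero>) \<in> affine_line R (Inl (m, b)) \<longleftrightarrow> b = \<zero>"
    if "m \<in> carrier R" "b \<in> carrier R" for m b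
    using that by auto
  \<comment> \<open>The total of one parallel class, indexed by the intercept or, for vertical
    lines, by the abscissa; the line through the origin has index 0.\<close>
  have one_line: "(\<Sum>c\<in>carrier R. if c = \<zero> then real q - 2 else real q - 1) = real q * (real q - 1) - 1"
  proof -
    have "(\<Sum>c\<in>carrier R. if c = \<zero> then real q - 2 else real q - 1) =
        (\<Sum>c\<in>carrier R. (real q - 1) - (if c = \<zero> then 1 else 0))"
      by (intro sum.cong) auto
    also have "\<dots> = real q * (real q - 1) - 1"
      using fin q by (simp add: sum_subtractf sum.delta)
    finally show ?thesis .
  qed
  have "(\<Sum>(m, b)\<in>carrier R \<times> carrier R. ?f (Inl (m, b))) =
      (\<Sum>(m, b)\<in>carrier R \<times> carrier R. if b = \<zero> then real q - 2 else real q - 1)"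
  proof (intro sum.cong refl, clarify)
    fix m b assume mb: "m \<in> carrier R" "b \<in> carrier R"
    then have "Inl (m, b) \<in> affine_lines R"
      by (auto simp: affine_lines_def)
    from card[OF this] show "?f (Inl (m, b)) = (if b = \<zero> then real q - 2 else real q - 1)"
      unfolding origin[OF mb] .
  qed
  also have "\<dots> = real q * (real q * (real q - 1) - 1)"
    using q by (simp add: one_line flip: sum.cartesian_product)
  finally have nonvertical: "(\<Sum>(m, b)\<in>carrier R \<times> carrier R. ?f (Inl (m, b))) =
      real q * (real q * (real q - 1) - 1)" .
  have vertical: "(\<Sum>c\<in>carrier R. ?f (Inr c)) =
      (\<Sum>c\<in>carrier R. if c = \<zero> then real q - 2 else real q - 1)"
    by (intro sum.cong refl) (subst card, auto simp: affine_lines_def)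
  show ?thesis
    using le unfolding sum_affine_lines nonvertical vertical one_line
    by (simp add: algebra_simps power2_eq_square power3_eq_cube)
qed

text \<open>The line \<open>x = 0\<close> is deleted both as a set of points and as a block. The
  \<open>q^2\<close> nonvertical lines lose one point each, the other \<open>q - 1\<close> vertical
  lines none, giving \<open>q^2 (q - 2) + (q - 1)^2\<close>.\<close>

lemma M_ge_affine_plane_minus_line:
  "real q ^ 3 - real q ^ 2 - 2 * real q + 1 \<le> M (q\<^sup>2 + q - 1) (q\<^sup>2 - q)"
proof -
  let ?V = "(carrier R - {\<zero>}) \<times> carrier R"
  let ?I = "affine_lines R - {Inr \<zero>}"
  let ?f = "\<lambda>l. real (card (affine_line R l \<inter> ?V) - 1)"
  have mem: "Inr \<zero> \<in> affine_lines R"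
    by (auto simp: affine_lines_def)
  have I: "finite ?I" "card ?I = q\<^sup>2 + q - 1"
    using fin q mem by (auto simp: finite_affine_lines card_affine_lines card_Diff_singleton)
  have V: "finite ?V" "card ?V = q\<^sup>2 - q"
    using fin q by (auto simp: card_Diff_singleton card_cartesian_product power2_eq_square diff_mult_distrib)
  have "\<exists>!l. l \<in> ?I \<and> A \<in> affine_line R l \<and> B \<in> affine_line R l"
    if "A \<in> ?V" "B \<in> ?V" "A \<noteq> B" for A B
  proof -
    have "A \<notin> affine_line R (Inr \<zero>)"
      using that by auto
    moreover have "\<exists>!l. l \<in> affine_lines R \<and> A \<in> affine_line R l \<and> B \<in> affine_line R l"
      using that by (intro ex1_affine_line_two_points) auto
    ultimately show ?thesis
      by (metis Diff_iff singletonD)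
  qed
  then have "(\<Sum>l\<in>?I. ?f l) \<le> M (q\<^sup>2 + q - 1) (q\<^sup>2 - q)"
    by (rule M_ge_sum_blocks[OF V I])
  moreover have "(\<Sum>l\<in>?I. ?f l) = (\<Sum>l\<in>affine_lines R. ?f l) - ?f (Inr \<zero>)"
    using fin mem by (simp add: sum_diff1 finite_affine_lines)
  \<comment> \<open>The deleted line has no points left, and truncated subtraction makes its term 0;
    hence the sum may still run over all affine lines.\<close>
  moreover have "?f (Inr \<zero>) = 0"
    by (simp add: Times_Int_Times)
  moreover have "(\<Sum>(m, b)\<in>carrier R \<times> carrier R. ?f (Inl (m, b))) =
      (\<Sum>(m, b)\<in>carrier R \<times> carrier R. real q - 2)"
  proof (intro sum.cong refl, clarify)
    fix m b assume mb: "m \<in> carrier R" "b \<in> carrier R"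
    have "affine_line R (Inl (m, b)) \<inter> ?V = (\<lambda>x. (x, m \<otimes> x \<oplus> b)) ` (carrier R - {\<zero>})"
      using mb by auto
    moreover have "card \<dots> = q - 1"
      using fin q by (subst card_image) (auto simp: inj_on_def card_Diff_singleton)
    ultimately show "?f (Inl (m, b)) = real q - 2"
      using card_carrier_ge_2 by (simp add: of_nat_diff)
  qed
  moreover have "(\<Sum>c\<in>carrier R. ?f (Inr c)) =
      (\<Sum>c\<in>carrier R. (real q - 1) - (if c = \<zero> then real q - 1 else 0))"
    using q card_carrier_ge_2
    by (intro sum.cong refl) (auto simp: Times_Int_Times card_cartesian_product of_nat_diff)
  moreover have "\<dots> = real q * (real q - 1) - (real q - 1)"
    using fin q by (simp add: sum_subtractf sum.delta)
  moreover have "(\<Sum>(m, b)\<in>carrier R \<times> carrier R. real q - 2) = real q ^ 2 * (real q - 2)"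
    using q by (simp add: card_cartesian_product power2_eq_square)
  moreover have "real q ^ 3 - real q ^ 2 - 2 * real q + 1 =
      real q ^ 2 * (real q - 2) + (real q * (real q - 1) - (real q - 1))"
    by (simp add: algebra_simps power2_eq_square power3_eq_cube)
  ultimately show ?thesis
    unfolding sum_affine_lines by linarith
qed

end

end

section \<open>Exact values of \<open>M\<close> where both bounds meet\<close>

theorem theorem6p2:
  fixes q n k :: nat
  assumes "primepow q" and "k \<le> n choose 2"
  shows
    "(n = q^2 + q + 1 \<and> k = q^2 + q + 1 \<longrightarrow>
        M k n = (real q ^ 2 + real q + 1) * real q \<and>
        M k n = real q * real k \<and>
        M k n = 2 / (real q + 1) * real (n choose 2)) \<and>
     (n = q^2 \<and> k = q^2 + q \<longrightarrow>
        M k n = (real q + 1) * real q * (real q - 1) \<and>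
        M k n = (real q - 1) * real k \<and>
        M k n = 2 / real q * real (n choose 2)) \<and>
     (n = q^2 + q \<and> k = q^2 + q + 1 \<longrightarrow>
        M k n = real q ^ 3 + real q ^ 2 - 1 \<and>
        M k n = real q * real k - real q - 1) \<and>
     (n = q^2 - 1 \<and> k = q^2 + q \<longrightarrow>
        M k n = real q ^ 3 - 2 * real q - 1 \<and>
        M k n = (real q - 1) * real k - real q - 1) \<and>
     (n = q^2 - q \<and> k = q^2 + q - 1 \<longrightarrow>
        M k n = real q ^ 3 - real q ^ 2 - 2 * real q + 1 \<and>
        M k n = (real q - 2) * real k + real q - 1)"
proof -
  obtain F :: "((int list \<times> nat) multiset \<Rightarrow> int) ring"
    where "field F" and F: "finite (carrier F)" "card (carrier F) = q"
    using finite_field_exists[OF assms(1)] by blast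
  interpret F: field F by fact
  have q: "q \<ge> 2"
    using F.card_carrier_ge_2[OF F] .
  have "q * 1 \<le> q * q"
    using q by (intro mult_le_mono2) simp
  then have qq: "q \<le> q^2"
    by (simp add: power2_eq_square)
  \<comment> \<open>By \<open>q \<ge> 2\<close> and \<open>q \<le> q^2\<close> none of these natural
    number subtractions is truncated.\<close>
  have real_sub: "real (q^2 - 1) = real q ^ 2 - 1" "real (q^2 - q) = real q ^ 2 - real q"
      "real (q^2 + q - 1) = real q ^ 2 + real q - 1" "real (q - 1) = real q - 1"
    using q qq by (simp_all add: of_nat_diff)
  note simps = algebra_simps power2_eq_square power3_eq_cube
  have i: "M (q^2 + q + 1) (q^2 + q + 1) = real q * real (q^2 + q + 1)"
    by (rule M_eqI[of _ q, OF _ _ F.M_ge_projective_plane[OF F]]) (use q in \<open>simp_all add: simps\<close>)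
  have ii: "M (q^2 + q) (q^2) = real (q - 1) * real (q^2 + q)"
    by (rule M_eqI[of _ "q - 1", OF _ _ F.M_ge_affine_plane[OF F]])
      (use q in \<open>simp_all add: real_sub simps\<close>)
  have iii: "M (q^2 + q + 1) (q^2 + q) = real q ^ 3 + real q ^ 2 - 1"
    by (rule M_eqI[of _ q, OF _ _ F.M_ge_projective_plane_minus_point[OF F]])
      (use q in \<open>simp_all add: simps\<close>)
  have iv: "M (q^2 + q) (q^2 - 1) = real q ^ 3 - 2 * real q - 1"
    by (rule M_eqI[of _ "q - 1", OF _ _ F.M_ge_affine_plane_minus_point[OF F]])
      (use q in \<open>simp_all only: real_sub, simp_all add: simps\<close>)
  have v: "M (q^2 + q - 1) (q^2 - q) = real q ^ 3 - real q ^ 2 - 2 * real q + 1"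
    by (rule M_eqI[of _ "q - 1", OF _ _ F.M_ge_affine_plane_minus_line[OF F]])
      (use q in \<open>simp_all only: real_sub, simp_all add: simps\<close>)
  have choose: "real (j choose 2) = real j * (real j - 1) / 2" for j
    using real_choose_two[of j] by simp
  have "real (q^2 + q + 1) - 1 = real q * (real q + 1)"
    by (simp add: simps)
  then have choose_i: "2 / (real q + 1) * real ((q^2 + q + 1) choose 2) = real q * real (q^2 + q + 1)"
    unfolding choose by (simp add: add_nonneg_eq_0_iff)
  have choose_ii: "2 / real q * real (q^2 choose 2) = real (q - 1) * real (q^2 + q)"
    unfolding choose using q by (simp add: real_sub field_simps simps)
  show ?thesis
    by (intro conjI impI; elim conjE)
      (simp_all only: i ii iii iv v choose_i choose_ii real_sub, simp_all add: simps)
qed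

end
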